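(* Let $G$ be an infinite countable residually finite amenable group, let $m\ge 2$ be an integer, and let $X\subset\{1,\dots,m\}^G$ be a shift of finite type whose set of periodic points is dense in $X$. Then $(X,G)$ has positive topological entropy if and only if its homoclinic equivalence relation $H_X$ is non-trivial.
   Context: $G$ is a discrete group. It is amenable if there is a sequence $\{F_n\}$ of nonempty finite subsets of $G$ (a Følner sequence) with $|gF_n\Delta F_n|/|F_n|\to0$ for every $g\in G$. It is residually finite if the intersection of all its normal subgroups of finite index is trivial. $G$ acts on the compact metrizable space $\{1,\dots,m\}^G$ (product topology) by $g'(x_g:g\in G)=(x_{gg'}:g\in G)$. A sub-shift is a nonempty closed subset $X\subset\{1,\dots,m\}^G$ with $gX=X$ for all $g\in G$. A sub-shift $X$ is a shift of finite type if there are a nonempty finite $F\subset G$ and a set $X_F\subset\{1,\dots,m\}^F$ such that $$X=\{(x_g)_{g\in G}: (x_{gg'})_{g\in F}\in X_F\ \text{for each}\ g'\in G\}.$$ The topological entropy of a sub-shift $X$ is $h_{\mathrm{top}}(G,X)=\lim_{n\to\infty}\frac1{|F_n|}\log|\pi_{F_n}(X)|$, where $\pi_F:\{1,\dots,m\}^G\to\{1,\dots,m\}^F$ is the natural projection and $\{F_n\}$ is a Følner sequence (the limit exists and does not depend on the Følner sequence; it equals the usual topological entropy defined via finite open covers). A point $x\in X$ is periodic if its orbit $Gx=\{gx:g\in G\}$ is finite. The homoclinic equivalence relation $H_X$ on $X$: $(x,x')\in H_X$ if and only if there is a finite $F\subset G$ such that $x_g=x'_g$ for all $g\in G\setminus F$.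 $H_X$ is non-trivial if $(x,x')\in H_X$ for some $x\neq x'$ in $X$. *)

theory Defs
  imports "HOL-Analysis.Analysis" "HOL-Algebra.Coset"
begin

section \<open>Discrete groups\<close>

definition folner_sequence :: "('a, 'b) monoid_scheme \<Rightarrow> (nat \<Rightarrow> 'a set) \<Rightarrow> bool" where
  "folner_sequence G F \<longleftrightarrow>
     (\<forall>n. finite (F n) \<and> F n \<noteq> {} \<and> F n \<subseteq> carrier G) \<and>
     (\<forall>g\<in>carrier G.
        (\<lambda>n. real (card (sym_diff (g <#\<^bsub>G\<^esub> F n) (F n))) / real (card (F n))) \<longlonglongrightarrow> 0)"

definition amenable :: "('a, 'b) monoid_scheme \<Rightarrow> bool" where
  "amenable G \<longleftrightarrow> (\<exists>F. folner_sequence G F)"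

definition residually_finite :: "('a, 'b) monoid_scheme \<Rightarrow> bool" where
  "residually_finite G \<longleftrightarrow> \<Inter>{N. N \<lhd> G \<and> finite (rcosets\<^bsub>G\<^esub> N)} = {\<one>\<^bsub>G\<^esub>}"

section \<open>Shift spaces\<close>

text \<open>
  Points of \<open>{1..m}\<^sup>G\<close> are extensional functions on \<open>carrier G\<close>
  (equal to \<open>undefined\<close> off the carrier), so that equality of functions is equality of points.
\<close>

definition full_shift :: "('a, 'b) monoid_scheme \<Rightarrow> nat \<Rightarrow> ('a \<Rightarrow> nat) topology" where
  "full_shift G m = product_topology (\<lambda>_. discrete_topology {1..m}) (carrier G)"

definition shift :: "('a, 'b) monoid_scheme \<Rightarrow> 'a \<Rightarrow> ('a \<Rightarrow> nat) \<Rightarrow> ('a \<Rightarrow> nat)" where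
  "shift G g' x = (\<lambda>g\<in>carrier G. x (g \<otimes>\<^bsub>G\<^esub> g'))"

definition subshift :: "('a, 'b) monoid_scheme \<Rightarrow> nat \<Rightarrow> ('a \<Rightarrow> nat) set \<Rightarrow> bool" where
  "subshift G m X \<longleftrightarrow>
     X \<noteq> {} \<and> closedin (full_shift G m) X \<and> (\<forall>g\<in>carrier G. shift G g ` X = X)"

definition shift_of_finite_type :: "('a, 'b) monoid_scheme \<Rightarrow> nat \<Rightarrow> ('a \<Rightarrow> nat) set \<Rightarrow> bool" where
  "shift_of_finite_type G m X \<longleftrightarrow>
     subshift G m X \<and>
     (\<exists>F XF. finite F \<and> F \<noteq> {} \<and> F \<subseteq> carrier G \<and> XF \<subseteq> (F \<rightarrow>\<^sub>E {1..m}) \<and>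
        X = {x \<in> carrier G \<rightarrow>\<^sub>E {1..m}.
               \<forall>g'\<in>carrier G. (\<lambda>g\<in>F. x (g \<otimes>\<^bsub>G\<^esub> g')) \<in> XF})"

definition periodic_points :: "('a, 'b) monoid_scheme \<Rightarrow> ('a \<Rightarrow> nat) set \<Rightarrow> ('a \<Rightarrow> nat) set" where
  "periodic_points G X = {x \<in> X. finite ((\<lambda>g. shift G g x) ` carrier G)}"

text \<open>
  For a subshift of an amenable group, the limit below exists along every Folner sequence and does
  not depend on the sequence, so the definite description denotes the common value.
  The image of \<open>X\<close> under \<open>\<lambda>x. restrict x F\<close> is the projection of \<open>X\<close> to the coordinates in \<open>F\<close>.
\<close>

definition topological_entropy :: "('a, 'b) monoid_scheme \<Rightarrow> ('a \<Rightarrow> nat) set \<Rightarrow> real" where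
  "topological_entropy G X =
     (THE h. \<forall>F. folner_sequence G F \<longrightarrow>
        (\<lambda>n. ln (real (card ((\<lambda>x. restrict x (F n)) ` X))) / real (card (F n))) \<longlonglongrightarrow> h)"

definition homoclinic_relation ::
  "('a, 'b) monoid_scheme \<Rightarrow> ('a \<Rightarrow> nat) set \<Rightarrow> (('a \<Rightarrow> nat) \<times> ('a \<Rightarrow> nat)) set" where
  "homoclinic_relation G X =
     {(x, x') \<in> X \<times> X. \<exists>F. finite F \<and> F \<subseteq> carrier G \<and> (\<forall>g\<in>carrier G - F. x g = x' g)}"

definition nontrivial_relation :: "('c \<times> 'c) set \<Rightarrow> bool" where
  "nontrivial_relation R \<longleftrightarrow> (\<exists>x x'. (x, x') \<in> R \<and> x \<noteq> x')"

end

theory Submission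
  imports Defs
begin

text \<open>
  By Shearer's inequality \<open>ln |\<pi>\<^sub>F X|\<close> is, up to boundary terms, at most
  \<open>|F| / |K|\<close> times \<open>ln |\<pi>\<^sub>K X|\<close> for every nonempty finite \<open>K\<close>: each element of \<open>F\<close> lies in
  exactly \<open>|K|\<close> right translates of \<open>K\<close>. Hence along every Folner sequence the entropy limit
  exists and is the infimum of \<open>ln |\<pi>\<^sub>K X| / |K|\<close> over \<open>K\<close>.

  If the homoclinic relation is trivial, a pattern on \<open>F\<close> is determined by its values near the
  boundary of \<open>F\<close>, since two points agreeing there could be spliced into a homoclinic pair; so
  the limit is zero. Conversely, let \<open>x \<noteq> x'\<close> be homoclinic and differ exactly on \<open>D\<close>. A periodic
  point that agrees with \<open>x\<close> on a large neighbourhood of \<open>D\<close> contains that block of \<open>x\<close> along a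
  finite-index subgroup of positions. At a separated set of these positions the block can be
  independently exchanged for that of \<open>x'\<close>, so \<open>ln |\<pi>\<^sub>K X|\<close> is at least a constant multiple
  of \<open>|K|\<close>, uniformly in \<open>K\<close>.
\<close>

section \<open>Shearer's inequality for projections\<close>

lemma arith_geom_mean_root:
  fixes f :: "'i \<Rightarrow> real"
  assumes "finite I" "I \<noteq> {}" "\<And>i. i \<in> I \<Longrightarrow> f i \<ge> 0"
  shows "root (card I) (\<Prod>i\<in>I. f i) \<le> (\<Sum>i\<in>I. f i) / card I"
  using arith_geom_mean[OF assms] assms
  by (simp add: root_powr_inverse card_gt_0_iff prod_nonneg sum_divide_distrib)

text \<open>This is Hoelder's inequality with \<open>card I\<close> equal exponents. After dividing
  each \<open>f i\<close> by its total over \<open>V\<close>, the arithmetic-geometric mean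
  inequality applies pointwise, and the sum over \<open>V\<close> of the resulting means is
  1.\<close>

lemma sum_root_prod_le:
  fixes f :: "'i \<Rightarrow> 'a \<Rightarrow> real"
  assumes "finite I" "I \<noteq> {}" "finite V" "\<And>i a. i \<in> I \<Longrightarrow> a \<in> V \<Longrightarrow> f i a \<ge> 0"
  shows "(\<Sum>a\<in>V. root (card I) (\<Prod>i\<in>I. f i a)) \<le> root (card I) (\<Prod>i\<in>I. \<Sum>a\<in>V. f i a)"
\<comment> \<open>Dividing by the totals requires them to be nonzero. If one total vanishes, that
  \<open>f i\<close> is zero on \<open>V\<close> and the inequality reads 0 \<le> 0.\<close>
proof (cases "\<exists>i\<in>I. (\<Sum>a\<in>V. f i a) = 0")
  case True
  then obtain i where i: "i \<in> I" "(\<Sum>a\<in>V. f i a) = 0" by blast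
  then have "\<forall>a\<in>V. f i a = 0"
    using assms sum_nonneg_eq_0_iff[of V "f i"] by simp
  then have "(\<Prod>i\<in>I. f i a) = 0" if "a \<in> V" for a
    using i assms(1) that by (intro prod_zero) auto
  moreover have "(\<Prod>i\<in>I. \<Sum>a\<in>V. f i a) = 0"
    using i assms(1) by (intro prod_zero) auto
  ultimately show ?thesis by simp
next
  case False
  let ?s = "\<lambda>i. \<Sum>a\<in>V. f i a" and ?k = "card I"
  have k: "?k > 0" using assms by (simp add: card_gt_0_iff)
  have s: "?s i > 0" if "i \<in> I" for i
    using False that assms sum_nonneg[of V "f i"] by (metis order_less_le)
  have "root ?k (\<Prod>i\<in>I. f i a) \<le> root ?k (\<Prod>i\<in>I. ?s i) * ((\<Sum>i\<in>I. f i a / ?s i) / ?k)"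
    if "a \<in> V" for a
  proof -
    have "(\<Prod>i\<in>I. f i a) = (\<Prod>i\<in>I. ?s i) * (\<Prod>i\<in>I. f i a / ?s i)"
      unfolding prod.distrib[symmetric] using s by (intro prod.cong) (auto simp: less_le)
    moreover have "root ?k (\<Prod>i\<in>I. f i a / ?s i) \<le> (\<Sum>i\<in>I. f i a / ?s i) / ?k"
      using assms s that by (intro arith_geom_mean_root) (auto simp: less_imp_le)
    moreover have "root ?k (\<Prod>i\<in>I. ?s i) \<ge> 0"
      using s k by (intro real_root_ge_zero prod_nonneg less_imp_le)
    ultimately show ?thesis
      by (simp only: real_root_mult mult_left_mono)
  qed
  then have "(\<Sum>a\<in>V. root ?k (\<Prod>i\<in>I. f i a))
      \<le> (\<Sum>a\<in>V. root ?k (\<Prod>i\<in>I. ?s i) * ((\<Sum>i\<in>I. f i a / ?s i) / ?k))"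
    by (rule sum_mono)
  also have "\<dots> = root ?k (\<Prod>i\<in>I. ?s i) * ((\<Sum>i\<in>I. \<Sum>a\<in>V. f i a / ?s i) / ?k)"
    unfolding sum.swap[of _ I V] sum_distrib_left sum_divide_distrib ..
  also have "(\<Sum>i\<in>I. \<Sum>a\<in>V. f i a / ?s i) = (\<Sum>i\<in>I. 1)"
    using s by (intro sum.cong) (auto simp: sum_divide_distrib[symmetric] less_le)
  finally show ?thesis using k by (simp only: sum_constant) simp
qed

text \<open>This is the projection \<pi>_J(A). The type of values is left arbitrary and
  \<open>A\<close> may itself be a set of patterns, so projections can be iterated.\<close>

definition patterns :: "'a set \<Rightarrow> ('a \<Rightarrow> 'v) set \<Rightarrow> ('a \<Rightarrow> 'v) set" where
  "patterns J A = (\<lambda>x. restrict x J) ` A"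

lemma patterns_patterns: "L \<subseteq> J \<Longrightarrow> patterns L (patterns J A) = patterns L A"
  by (auto simp: patterns_def image_image inf_absorb2)

lemma card_patterns_mono:
  assumes "L \<subseteq> J" "finite (patterns J A)"
  shows "card (patterns L A) \<le> card (patterns J A)"
  using card_image_le[OF assms(2), of "\<lambda>x. restrict x L"] patterns_patterns[OF assms(1), of A]
  by (simp add: patterns_def)

text \<open>A pattern on \<open>insert j L\<close> amounts to its value \<open>a\<close> at
  \<open>j\<close> together with a pattern on \<open>L\<close> coming from the fibre over
  \<open>a\<close>. This is the recursion that drives the induction for Shearer's
  inequality.\<close>

lemma card_patterns_insert:
  assumes "finite A" "j \<notin> L"
  shows "card (patterns (insert j L) A) = (\<Sum>a\<in>(\<lambda>x. x j) ` A. card (patterns L {x \<in> A. x j = a}))"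
proof -
  have "(\<lambda>f. (f j, restrict f L)) ` patterns (insert j L) A
      = (SIGMA a:(\<lambda>x. x j) ` A. patterns L {x \<in> A. x j = a})"
  proof -
    have "(SIGMA a:(\<lambda>x. x j) ` A. patterns L {x \<in> A. x j = a}) = (\<lambda>x. (x j, restrict x L)) ` A"
      by (auto simp: patterns_def intro: rev_image_eqI)
    moreover have "insert j L \<inter> L = L" by auto
    ultimately show ?thesis by (simp add: patterns_def image_image)
  qed
  moreover have "inj_on (\<lambda>f. (f j, restrict f L)) (patterns (insert j L) A)"
  proof (rule inj_onI)
    fix f g assume fg: "f \<in> patterns (insert j L) A" "g \<in> patterns (insert j L) A"
      "(f j, restrict f L) = (g j, restrict g L)"
    then have "f \<in> extensional (insert j L)" "g \<in> extensional (insert j L)"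
      by (auto simp: patterns_def)
    moreover have "f i = g i" if "i \<in> insert j L" for i
      using fg(3) that by (metis insertE prod.inject restrict_apply')
    ultimately show "f = g" by (rule extensionalityI)
  qed
  ultimately have "card (patterns (insert j L) A)
      = card (SIGMA a:(\<lambda>x. x j) ` A. patterns L {x \<in> A. x j = a})"
    using card_image by fastforce
  also have "\<dots> = (\<Sum>a\<in>(\<lambda>x. x j) ` A. card (patterns L {x \<in> A. x j = a}))"
    using assms by (intro card_SigmaI) (auto simp: patterns_def)
  finally show ?thesis .
qed

text \<open>Induction on the coordinates: split \<open>A\<close> by its value at \<open>j\<close> and sum with Hoelder's inequality.\<close>

lemma Shearer_inequality_root:
  assumes "finite J" "finite I" "k > 0" "finite A"
    and "\<And>i. i \<in> I \<Longrightarrow> K i \<subseteq> J"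
    and "\<And>j. j \<in> J \<Longrightarrow> card {i \<in> I. j \<in> K i} = k"
  shows "real (card (patterns J A)) \<le> root k (\<Prod>i\<in>I. real (card (patterns (K i) A)))"
  using assms(1,4-)
proof (induction J arbitrary: A K rule: finite_induct)
  case empty
  then have "(\<Prod>i\<in>I. real (card (patterns (K i) A))) = (\<Prod>i\<in>I. real (card (patterns {} A)))"
    by (intro prod.cong) auto
  moreover have "patterns {} A = (if A = {} then {} else {\<lambda>_. undefined})"
    by (auto simp: patterns_def restrict_def)
  ultimately show ?case using assms(3) by (auto simp: prod_nonneg)
next
  case (insert j J)
  define V where "V = (\<lambda>x. x j) ` A"
  define S where "S a = {x \<in> A. x j = a}" for a
  \<comment> \<open>Only the \<open>k\<close> sets containing \<open>j\<close> shrink when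
    \<open>j\<close> is removed and regain their size when the fibres are summed.\<close>
  define I1 where "I1 = {i \<in> I. j \<in> K i}"
  define I0 where "I0 = {i \<in> I. j \<notin> K i}"
  let ?r = "\<lambda>i a. real (card (patterns (K i - {j}) (S a)))"
  let ?c = "\<lambda>i. real (card (patterns (K i) A))"
  have I: "I = I0 \<union> I1" "I0 \<inter> I1 = {}" "finite I0" "finite I1" "card I1 = k"
    using insert.prems(3)[of j] \<open>finite I\<close> by (auto simp: I0_def I1_def)
  have S: "finite (S a)" "S a \<subseteq> A" for a using insert by (auto simp: S_def)
  have split: "(\<Prod>i\<in>I. g i) = (\<Prod>i\<in>I0. g i) * (\<Prod>i\<in>I1. g i)" for g :: "_ \<Rightarrow> real"
    unfolding I(1) using I by (intro prod.union_disjoint) auto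
  \<comment> \<open>For \<open>i \<in> I0\<close> the count on a fibre is bounded by the count for
    all of \<open>A\<close>. This factor no longer depends on \<open>a\<close>, so it can leave the
    sum.\<close>
  have le: "real (card (patterns J (S a))) \<le> root k (\<Prod>i\<in>I0. ?c i) * root k (\<Prod>i\<in>I1. ?r i a)" for a
  proof -
    have "real (card (patterns J (S a))) \<le> root k (\<Prod>i\<in>I. ?r i a)"
    proof (rule insert.IH)
      show "K i - {j} \<subseteq> J" if "i \<in> I" for i using insert.prems(2)[OF that] by auto
      show "card {i \<in> I. j' \<in> K i - {j}} = k" if "j' \<in> J" for j'
      proof -
        have "{i \<in> I. j' \<in> K i - {j}} = {i \<in> I. j' \<in> K i}" using that insert by auto
        then show ?thesis using insert.prems(3)[of j'] that by simp
      qed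
    qed (rule S)
    also have "(\<Prod>i\<in>I. ?r i a) = (\<Prod>i\<in>I0. ?r i a) * (\<Prod>i\<in>I1. ?r i a)" by (rule split)
    also have "\<dots> \<le> (\<Prod>i\<in>I0. ?c i) * (\<Prod>i\<in>I1. ?r i a)"
    proof (intro mult_right_mono prod_mono conjI prod_nonneg)
      fix i assume "i \<in> I0"
      then have "patterns (K i - {j}) (S a) \<subseteq> patterns (K i) A"
        using S by (auto simp: I0_def patterns_def)
      then show "?r i a \<le> ?c i"
        using insert.prems by (simp add: card_mono patterns_def)
    qed auto
    finally show ?thesis using assms(3) by (simp add: real_root_mult)
  qed
  have "real (card (patterns (insert j J) A)) = (\<Sum>a\<in>V. real (card (patterns J (S a))))"
    using card_patterns_insert[OF insert.prems(1) insert.hyps(2)] by (simp add: V_def S_def)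
  also have "\<dots> \<le> (\<Sum>a\<in>V. root k (\<Prod>i\<in>I0. ?c i) * root k (\<Prod>i\<in>I1. ?r i a))"
    by (intro sum_mono le)
  \<comment> \<open>Since \<open>card I1 = k\<close>, the root has exactly the exponent that
    Hoelder's inequality over \<open>I1\<close> requires.\<close>
  also have "\<dots> = root k (\<Prod>i\<in>I0. ?c i) * (\<Sum>a\<in>V. root (card I1) (\<Prod>i\<in>I1. ?r i a))"
    by (simp add: sum_distrib_left I)
  also have "\<dots> \<le> root k (\<Prod>i\<in>I0. ?c i) * root (card I1) (\<Prod>i\<in>I1. \<Sum>a\<in>V. ?r i a)"
    using I assms(3) insert.prems
    by (intro mult_left_mono sum_root_prod_le) (auto simp: V_def prod_nonneg)
  also have "(\<Prod>i\<in>I1. \<Sum>a\<in>V. ?r i a) = (\<Prod>i\<in>I1. ?c i)"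
  proof (rule prod.cong)
    fix i assume "i \<in> I1"
    then have "insert j (K i - {j}) = K i" by (auto simp: I1_def)
    then show "(\<Sum>a\<in>V. ?r i a) = ?c i"
      using card_patterns_insert[OF insert.prems(1), of j "K i - {j}"] by (simp add: V_def S_def)
  qed simp
  also have "root k (\<Prod>i\<in>I0. ?c i) * root (card I1) (\<Prod>i\<in>I1. ?c i) = root k (\<Prod>i\<in>I. ?c i)"
    unfolding split I(5) by (simp add: real_root_mult)
  finally show ?case .
qed

text \<open>Here \<open>A\<close> may be infinite, as a subshift usually is: the root form is
  applied to the finite set \<open>patterns J A\<close>, which has the same projections to subsets
  of \<open>J\<close>.\<close>

lemma Shearer_inequality_ln:
  assumes "finite J" "finite I" "k > 0" "finite (patterns J A)" "A \<noteq> {}"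
    and K: "\<And>i. i \<in> I \<Longrightarrow> K i \<subseteq> J"
    and "\<And>j. j \<in> J \<Longrightarrow> card {i \<in> I. j \<in> K i} = k"
  shows "k * ln (card (patterns J A)) \<le> (\<Sum>i\<in>I. ln (card (patterns (K i) A)))"
proof -
  have pos: "card (patterns (K i) A) > 0" if "i \<in> I" for i
    using assms(4,5) patterns_patterns[OF K[OF that], of A, symmetric]
    by (simp add: card_gt_0_iff patterns_def)
  have "real (card (patterns J (patterns J A))) \<le> root k (\<Prod>i\<in>I. real (card (patterns (K i) (patterns J A))))"
    using assms by (intro Shearer_inequality_root) auto
  then have "real (card (patterns J A)) \<le> root k (\<Prod>i\<in>I. real (card (patterns (K i) A)))"
    by (simp add: patterns_patterns K)
  moreover have "card (patterns J A) > 0"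
    using assms by (simp add: card_gt_0_iff) (simp add: patterns_def)
  ultimately have "ln (real (card (patterns J A))) \<le> ln (root k (\<Prod>i\<in>I. real (card (patterns (K i) A))))"
    by (metis ln_le_cancel_iff of_nat_0_less_iff order_less_le_trans)
  also have "\<dots> = (\<Sum>i\<in>I. ln (card (patterns (K i) A))) / k"
    using pos assms by (subst ln_root) (auto simp: ln_prod prod_pos)
  finally show ?thesis using assms(3) by (simp add: field_simps)
qed

section \<open>The infimum rule for the entropy of a subshift\<close>

lemma subshift_subset: "subshift G m X \<Longrightarrow> X \<subseteq> carrier G \<rightarrow>\<^sub>E {1..m}"
  using closedin_subset[of "full_shift G m" X]
  by (simp add: subshift_def full_shift_def)

lemma patterns_subset_PiE:
  assumes "X \<subseteq> J \<rightarrow>\<^sub>E V" "L \<subseteq> J"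
  shows "patterns L X \<subseteq> L \<rightarrow>\<^sub>E V"
  using assms by (fastforce simp: patterns_def PiE_iff)

lemma finite_patterns:
  assumes "X \<subseteq> J \<rightarrow>\<^sub>E {1..m::nat}" "L \<subseteq> J" "finite L"
  shows "finite (patterns L X)"
  by (rule finite_subset[OF patterns_subset_PiE[OF assms(1,2)]]) (simp add: finite_PiE assms)

lemma card_patterns_le:
  assumes "X \<subseteq> J \<rightarrow>\<^sub>E {1..m::nat}" "L \<subseteq> J" "finite L"
  shows "card (patterns L X) \<le> m ^ card L"
  using card_mono[OF _ patterns_subset_PiE[OF assms(1,2)]] assms(3)
  by (simp add: finite_PiE card_PiE)

lemma card_patterns_pos: "finite (patterns L X) \<Longrightarrow> X \<noteq> {} \<Longrightarrow> card (patterns L X) > 0"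
  by (auto simp: card_gt_0_iff patterns_def)

lemma l_coset_eq_image: "g <#\<^bsub>G\<^esub> F = (\<lambda>h. g \<otimes>\<^bsub>G\<^esub> h) ` F"
  by (auto simp: l_coset_def)

lemma r_coset_eq_image: "F #>\<^bsub>G\<^esub> g = (\<lambda>h. h \<otimes>\<^bsub>G\<^esub> g) ` F"
  by (auto simp: r_coset_def)

context group
begin

lemma inv_mult_cancel [simp]:
  "a \<in> carrier G \<Longrightarrow> b \<in> carrier G \<Longrightarrow> inv a \<otimes> (a \<otimes> b) = b"
  "a \<in> carrier G \<Longrightarrow> b \<in> carrier G \<Longrightarrow> a \<otimes> (inv a \<otimes> b) = b"
  by (simp_all add: m_assoc[symmetric])

text \<open>Shifting by \<open>c\<close> moves the value at \<open>k \<otimes> c\<close> to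
  \<open>k\<close>, which matches patterns on \<open>K #> c\<close> with patterns on
  \<open>K\<close>. So right translates preserve counts, whereas Folner sets are almost invariant
  under left translates.\<close>

lemma card_patterns_r_coset:
  assumes "shift G c ` X = X" "c \<in> carrier G" "K \<subseteq> carrier G"
  shows "card (patterns (K #> c) X) = card (patterns K X)"
proof -
  define T where "T f = (\<lambda>k\<in>K. f (k \<otimes> c))" for f :: "'a \<Rightarrow> nat"
  have "patterns K X = patterns K (shift G c ` X)" by (simp add: assms)
  also have "\<dots> = T ` patterns (K #> c) X"
    unfolding patterns_def image_image
    using assms by (intro image_cong refl ext) (auto simp: T_def shift_def r_coset_eq_image)
  finally have "patterns K X = T ` patterns (K #> c) X" .
  moreover have "inj_on T (patterns (K #> c) X)"
  proof (rule inj_onI)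
    fix f g assume fg: "f \<in> patterns (K #> c) X" "g \<in> patterns (K #> c) X" "T f = T g"
    then have "f \<in> extensional (K #> c)" "g \<in> extensional (K #> c)"
      by (auto simp: patterns_def)
    moreover have "f i = g i" if i: "i \<in> K #> c" for i
    proof -
      obtain h where "h \<in> K" "i = h \<otimes> c" using i by (auto simp: r_coset_eq_image)
      then show ?thesis using fun_cong[OF fg(3), of h] by (simp add: T_def)
    qed
    ultimately show "f = g" by (rule extensionalityI)
  qed
  ultimately show ?thesis by (simp add: card_image)
qed

lemma card_Union_l_coset_le:
  assumes "finite K" "finite F"
  shows "real (card (\<Union>k\<in>K. k <# F)) \<le> card F + (\<Sum>k\<in>K. real (card (sym_diff (k <# F) F)))"
proof -
  have fin: "finite (sym_diff (k <# F) F)" for k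
    using assms by (simp add: l_coset_eq_image)
  have "(\<Union>k\<in>K. k <# F) \<subseteq> F \<union> (\<Union>k\<in>K. sym_diff (k <# F) F)" by blast
  then have "card (\<Union>k\<in>K. k <# F) \<le> card (F \<union> (\<Union>k\<in>K. sym_diff (k <# F) F))"
    using assms fin by (intro card_mono) auto
  also have "\<dots> \<le> card F + card (\<Union>k\<in>K. sym_diff (k <# F) F)" by (rule card_Un_le)
  also have "\<dots> \<le> card F + (\<Sum>k\<in>K. card (sym_diff (k <# F) F))"
    using card_UN_le[OF assms(1)] by simp
  finally show ?thesis by (simp flip: of_nat_sum of_nat_add)
qed

text \<open>Shearer's inequality is applied to the sets \<open>(K #> c) \<inter> F\<close>. A point
  \<open>f\<close> lies in \<open>K #> c\<close> exactly when \<open>c = inv k \<otimes> f\<close>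
  for some \<open>k \<in> K\<close>, so it is covered \<open>card K\<close> times, and the relevant
  \<open>c\<close> fill left translates of \<open>F\<close>.\<close>

lemma ln_card_patterns_le:
  assumes X: "subshift G m X"
    and K: "finite K" "K \<noteq> {}" "K \<subseteq> carrier G" and F: "finite F" "F \<subseteq> carrier G"
  shows "card K * ln (card (patterns F X))
    \<le> card (\<Union>k\<in>m_inv G ` K. k <# F) * ln (card (patterns K X))"
proof -
  define I where "I = (\<Union>k\<in>m_inv G ` K. k <# F)"
  have sub: "X \<subseteq> carrier G \<rightarrow>\<^sub>E {1..m}" and ne: "X \<noteq> {}"
    using subshift_subset[OF X] X by (auto simp: subshift_def)
  have I: "finite I" "I \<subseteq> carrier G"
    using K F by (auto simp: I_def l_coset_eq_image)
  have "card K * ln (card (patterns F X)) \<le> (\<Sum>c\<in>I. ln (card (patterns ((K #> c) \<inter> F) X)))"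
  proof (rule Shearer_inequality_ln)
    show "card K > 0" using K by (simp add: card_gt_0_iff)
    show "finite (patterns F X)" by (rule finite_patterns[OF sub F(2,1)])
    show "card {c \<in> I. f \<in> (K #> c) \<inter> F} = card K" if f: "f \<in> F" for f
    proof -
      have fc: "f \<in> carrier G" using f F by blast
      have "{c \<in> I. f \<in> (K #> c) \<inter> F} = (\<lambda>k. inv k \<otimes> f) ` K"
      proof (intro equalityI subsetI)
        fix c assume "c \<in> {c \<in> I. f \<in> (K #> c) \<inter> F}"
        then obtain k where "k \<in> K" "f = k \<otimes> c" "c \<in> carrier G"
          using I by (auto simp: r_coset_eq_image)
        then show "c \<in> (\<lambda>k. inv k \<otimes> f) ` K"
          using K by (intro image_eqI[of _ _ k]) auto
      next
        fix c assume "c \<in> (\<lambda>k. inv k \<otimes> f) ` K"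
        then obtain k where k: "k \<in> K" "c = inv k \<otimes> f" by blast
        then have "f = k \<otimes> c" using K fc by auto
        with k f show "c \<in> {c \<in> I. f \<in> (K #> c) \<inter> F}"
          by (auto simp: I_def l_coset_eq_image r_coset_eq_image)
      qed
      moreover have "inj_on (\<lambda>k. inv k \<otimes> f) K"
        using K fc by (intro inj_onI) (metis inv_closed inv_inv right_cancel subsetD)
      ultimately show ?thesis by (simp add: card_image)
    qed
  qed (use F I ne in auto)
  \<comment> \<open>Cutting a translate down to \<open>F\<close> only lowers its count, and the full
    translate has the count of \<open>K\<close>.\<close>
  also have "\<dots> \<le> (\<Sum>c\<in>I. ln (card (patterns K X)))"
  proof (intro sum_mono)
    fix c assume "c \<in> I"
    then have c: "c \<in> carrier G" using I by blast
    then have Kc: "K #> c \<subseteq> carrier G" "finite (K #> c)"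
      using K by (auto simp: r_coset_eq_image)
    then have fin: "finite (patterns (K #> c) X)" "finite (patterns ((K #> c) \<inter> F) X)"
      using F by (auto intro!: finite_patterns[OF sub])
    have "card (patterns ((K #> c) \<inter> F) X) \<le> card (patterns (K #> c) X)"
      using fin by (intro card_patterns_mono) auto
    also have "\<dots> = card (patterns K X)"
      using X c K by (intro card_patterns_r_coset) (auto simp: subshift_def)
    finally show "ln (card (patterns ((K #> c) \<inter> F) X)) \<le> ln (card (patterns K X))"
      using card_patterns_pos[OF fin(2) ne] by simp
  qed
  finally show ?thesis by (simp add: I_def)
qed

text \<open>Each \<open>F n\<close> is itself a competitor in the infimum, which gives the lower
  bound. For the upper bound, \<open>ln_card_patterns_le\<close> is used with one nearly optimal
  \<open>K\<close>, and the Folner property makes the number of translates asymptotic to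
  \<open>card (F n)\<close>.\<close>

lemma entropy_limit:
  assumes X: "subshift G m X" and F: "folner_sequence G F"
  shows "(\<lambda>n. ln (card (patterns (F n) X)) / card (F n)) \<longlonglongrightarrow>
    (INF K\<in>{K. finite K \<and> K \<noteq> {} \<and> K \<subseteq> carrier G}. ln (card (patterns K X)) / card K)"
    (is "?f \<longlonglongrightarrow> (INF K\<in>?S. ?e K)")
proof (rule order_tendstoI)
  have sub: "X \<subseteq> carrier G \<rightarrow>\<^sub>E {1..m}" and ne: "X \<noteq> {}"
    using subshift_subset[OF X] X by (auto simp: subshift_def)
  have pos: "card (patterns K X) > 0" if "K \<in> ?S" for K
    using that by (intro card_patterns_pos finite_patterns[OF sub] ne) auto
  \<comment> \<open>A real infimum is meaningful only for a set bounded below; here 0 is a bound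
    because every count is at least 1.\<close>
  have bdd: "bdd_below (?e ` ?S)"
    using pos by (intro bdd_belowI2[of _ 0]) (auto simp: Suc_le_eq intro!: divide_nonneg_nonneg ln_ge_zero)
  have FS: "F n \<in> ?S" for n using F by (auto simp: folner_sequence_def)
  {
    fix a assume "a < (INF K\<in>?S. ?e K)"
    then have "a < ?f n" for n
      using cINF_lower[OF bdd FS[of n]] by linarith
    then show "\<forall>\<^sub>F n in sequentially. a < ?f n" by simp
  next
    fix a assume lt: "(INF K\<in>?S. ?e K) < a"
    have ne: "?e ` ?S \<noteq> {}" using FS[of 0] by (simp only: image_is_empty) (metis empty_iff)
    have "\<exists>K\<in>?S. ?e K < a" using cInf_lessD[OF ne lt] by (simp only: bex_simps)
    then obtain K where K: "K \<in> ?S" "?e K < a" by (rule bexE)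
    \<comment> \<open>The relative excess of the union of the translates \<open>inv k <# F n\<close>
      over \<open>F n\<close>; it is a finite sum of Folner errors.\<close>
    define r where "r n = (\<Sum>k\<in>m_inv G ` K. real (card (sym_diff (k <# F n) (F n))) / card (F n))" for n
    have "r \<longlonglongrightarrow> (\<Sum>k\<in>m_inv G ` K. 0)"
      unfolding r_def using K F by (intro tendsto_sum) (auto simp: folner_sequence_def)
    then have "(\<lambda>n. (1 + r n) * ?e K) \<longlonglongrightarrow> (1 + 0) * ?e K"
      by (intro tendsto_intros) simp
    then have "\<forall>\<^sub>F n in sequentially. (1 + r n) * ?e K < a"
      using K(2) by (intro order_tendstoD(2)) auto
    moreover have "?f n \<le> (1 + r n) * ?e K" for n
    proof -
      have Fn: "card (F n) > 0" "F n \<noteq> {}" "finite (F n)" "F n \<subseteq> carrier G" using FS[of n] by (auto simp: card_gt_0_iff)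
      have Kp: "card K > 0" using K by (auto simp: card_gt_0_iff)
      have "card K * ln (card (patterns (F n) X))
          \<le> card (\<Union>k\<in>m_inv G ` K. k <# F n) * ln (card (patterns K X))"
        using K Fn by (intro ln_card_patterns_le[OF X]) auto
      also have "\<dots> \<le> (card (F n) + (\<Sum>k\<in>m_inv G ` K. real (card (sym_diff (k <# F n) (F n))))) * ln (card (patterns K X))"
        using K Fn pos[OF K(1)]
        by (intro mult_right_mono card_Union_l_coset_le) (auto simp: Suc_le_eq)
      also have "\<dots> = card (F n) * (1 + r n) * ln (card (patterns K X))"
        using Fn by (simp add: r_def sum_divide_distrib[symmetric] field_simps)
      finally show ?thesis
        using Fn Kp by (simp add: field_simps)
    qed
    ultimately show "\<forall>\<^sub>F n in sequentially. ?f n < a"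
      by (auto elim!: eventually_mono intro: le_less_trans)
  }
qed

end

text \<open>Amenability supplies a Folner sequence; without one every real number would satisfy the
  definite description.\<close>

lemma topological_entropy_eqI:
  assumes "amenable G"
    and "\<And>F. folner_sequence G F \<Longrightarrow> (\<lambda>n. ln (card (patterns (F n) X)) / card (F n)) \<longlonglongrightarrow> h"
  shows "topological_entropy G X = h"
  unfolding topological_entropy_def
proof (rule the_equality)
  show "\<forall>F. folner_sequence G F \<longrightarrow>
      (\<lambda>n. ln (real (card ((\<lambda>x. restrict x (F n)) ` X))) / real (card (F n))) \<longlonglongrightarrow> h"
    using assms(2) by (simp add: patterns_def)
next
  fix h' assume h': "\<forall>F. folner_sequence G F \<longrightarrow>
      (\<lambda>n. ln (real (card ((\<lambda>x. restrict x (F n)) ` X))) / real (card (F n))) \<longlonglongrightarrow> h'"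
  obtain F where F: "folner_sequence G F" using assms(1) by (auto simp: amenable_def)
  show "h' = h"
    using h' F assms(2)[OF F] by (auto simp: patterns_def intro: LIMSEQ_unique)
qed

section \<open>Exchanging patterns in a shift of finite type\<close>

context group
begin

text \<open>The finite-type condition with its window \<open>W\<close> and allowed patterns
  \<open>XW\<close> named, so that later constructions can refer to them.\<close>

definition allowed_by_windows :: "'a set \<Rightarrow> ('a \<Rightarrow> nat) set \<Rightarrow> nat \<Rightarrow> ('a \<Rightarrow> nat) set \<Rightarrow> bool" where
  "allowed_by_windows W XW m X \<longleftrightarrow> finite W \<and> W \<noteq> {} \<and> W \<subseteq> carrier G \<and>
     X = {x \<in> carrier G \<rightarrow>\<^sub>E {1..m}. \<forall>g'\<in>carrier G. (\<lambda>g\<in>W. x (g \<otimes> g')) \<in> XW}"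

text \<open>Gluing principle: each window of \<open>z\<close> only has to occur in some point of
  \<open>X\<close>, which may vary with the window and may be read at a translated position.\<close>

lemma mem_by_windows:
  assumes sft: "allowed_by_windows W XW m X"
    and z: "z \<in> carrier G \<rightarrow>\<^sub>E {1..m}"
    and loc: "\<And>g. g \<in> carrier G \<Longrightarrow> \<exists>u\<in>X. \<exists>c\<in>carrier G. \<forall>w\<in>W. z (w \<otimes> g) = u (w \<otimes> (g \<otimes> c))"
  shows "z \<in> X"
proof -
  have X: "X = {x \<in> carrier G \<rightarrow>\<^sub>E {1..m}. \<forall>g'\<in>carrier G. (\<lambda>g\<in>W. x (g \<otimes> g')) \<in> XW}"
    using sft by (simp add: allowed_by_windows_def)
  have "(\<lambda>w\<in>W. z (w \<otimes> g)) \<in> XW" if g: "g \<in> carrier G" for g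
  proof -
    obtain u c where u: "u \<in> X" "c \<in> carrier G" "\<forall>w\<in>W. z (w \<otimes> g) = u (w \<otimes> (g \<otimes> c))"
      using loc[OF g] by blast
    then have "(\<lambda>w\<in>W. z (w \<otimes> g)) = (\<lambda>w\<in>W. u (w \<otimes> (g \<otimes> c)))"
      by (intro restrict_ext) auto
    also have "\<dots> \<in> XW"
      using u g unfolding X by blast
    finally show ?thesis .
  qed
  with z show ?thesis unfolding X by blast
qed

text \<open>The point \<open>y\<close> carries the block of \<open>x\<close> on each
  \<open>E \<otimes> c\<close>. For every \<open>S \<subseteq> C\<close> the blocks at
  \<open>c \<in> S\<close> are exchanged for those of \<open>x'\<close>. Any window meeting an
  exchanged copy of \<open>D\<close> lies inside that copy of \<open>E\<close>, so no forbidden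
  window arises.\<close>

lemma two_power_le_card_patterns:
  assumes sft: "allowed_by_windows W XW m X"
    and pts: "x \<in> X" "x' \<in> X" "y \<in> X"
    and D: "D \<subseteq> E" "E \<subseteq> carrier G" "\<And>g. g \<in> carrier G - D \<Longrightarrow> x g = x' g"
    and d0: "d0 \<in> D" "x d0 \<noteq> x' d0"
    and E: "\<And>w w' g. w \<in> W \<Longrightarrow> w' \<in> W \<Longrightarrow> g \<in> carrier G \<Longrightarrow> w \<otimes> g \<in> D \<Longrightarrow> w' \<otimes> g \<in> E"
    and C: "finite C" "C \<subseteq> carrier G" "\<And>c e. c \<in> C \<Longrightarrow> e \<in> E \<Longrightarrow> y (e \<otimes> c) = x e"
    and sep: "\<And>c c' e d. c \<in> C \<Longrightarrow> c' \<in> C \<Longrightarrow> e \<in> E \<Longrightarrow> d \<in> D \<Longrightarrow> e \<otimes> c = d \<otimes> c' \<Longrightarrow> c = c'"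
    and K: "finite K" "K \<subseteq> carrier G" "\<And>c. c \<in> C \<Longrightarrow> d0 \<otimes> c \<in> K"
  shows "2 ^ card C \<le> card (patterns K X)"
proof -
  have sub: "X \<subseteq> carrier G \<rightarrow>\<^sub>E {1..m}" and W: "W \<subseteq> carrier G"
    using sft by (auto simp: allowed_by_windows_def)
  \<comment> \<open>Only the copies of \<open>D\<close> are rewritten, since \<open>x\<close> and
    \<open>x'\<close> agree on the rest of \<open>E\<close>. For \<open>S \<subseteq> C\<close> the
    separation hypothesis makes the chosen \<open>c\<close> unique.\<close>
  define z where "z S = (\<lambda>g\<in>carrier G. if \<exists>c\<in>S. g \<otimes> inv c \<in> D
      then x' (g \<otimes> inv (SOME c. c \<in> S \<and> g \<otimes> inv c \<in> D)) else y g)" for S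
  have z_out: "z S g = y g" if "g \<in> carrier G" "\<And>c. c \<in> S \<Longrightarrow> g \<otimes> inv c \<notin> D" for S g
    using that by (auto simp: z_def)
  have uniq: "c' = c" if "c \<in> C" "c' \<in> C" "e \<in> E" "(e \<otimes> c) \<otimes> inv c' \<in> D" for c c' e
  proof -
    have "e \<in> carrier G" "c \<in> carrier G" "c' \<in> carrier G" using that D C by auto
    then have "e \<otimes> c = ((e \<otimes> c) \<otimes> inv c') \<otimes> c'" by (simp add: m_assoc)
    with sep[OF that(1-4)] show ?thesis by simp
  qed
  have z_in: "z S (e \<otimes> c) = x' e" if S: "S \<subseteq> C" "c \<in> S" "e \<in> E" for S c e
  proof -
    have carr: "e \<in> carrier G" "c \<in> carrier G" using S D C by auto
    have ec: "(e \<otimes> c) \<otimes> inv c = e" using carr by (simp add: m_assoc)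
    show ?thesis
    proof (cases "e \<in> D")
      case True
      have "(SOME c'. c' \<in> S \<and> (e \<otimes> c) \<otimes> inv c' \<in> D) = c"
      proof (rule some_equality)
        show "c \<in> S \<and> (e \<otimes> c) \<otimes> inv c \<in> D" using True S ec by simp
        show "c' = c" if "c' \<in> S \<and> (e \<otimes> c) \<otimes> inv c' \<in> D" for c'
          using uniq[of c c' e] that S by auto
      qed
      then show ?thesis using True S ec carr by (auto simp: z_def)
    next
      case False
      have "(e \<otimes> c) \<otimes> inv c' \<notin> D" if "c' \<in> S" for c'
        using uniq[of c c' e] that subsetD[OF S(1)] S ec False by metis
      then have "z S (e \<otimes> c) = y (e \<otimes> c)" using carr by (intro z_out) auto
      also have "\<dots> = x e" using C S by auto
      also have "\<dots> = x' e" using D carr False by auto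
      finally show ?thesis .
    qed
  qed
  have zX: "z S \<in> X" if S: "S \<subseteq> C" for S
  proof (rule mem_by_windows[OF sft])
    show "z S \<in> carrier G \<rightarrow>\<^sub>E {1..m}"
    proof (rule PiE_I)
      fix g assume g: "g \<in> carrier G"
      have range: "u h \<in> {1..m}" if "u \<in> X" "h \<in> carrier G" for u h
        using sub that by (auto simp: PiE_iff)
      have "(SOME c. c \<in> S \<and> g \<otimes> inv c \<in> D) \<in> carrier G" if "\<exists>c\<in>S. g \<otimes> inv c \<in> D"
        using someI_ex[of "\<lambda>c. c \<in> S \<and> g \<otimes> inv c \<in> D"] that S C by blast
      then show "z S g \<in> {1..m}"
        using g range pts by (simp add: z_def del: atLeastAtMost_iff)
    qed (simp add: z_def)
    fix g assume g: "g \<in> carrier G"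
    show "\<exists>u\<in>X. \<exists>c\<in>carrier G. \<forall>w\<in>W. z S (w \<otimes> g) = u (w \<otimes> (g \<otimes> c))"
    \<comment> \<open>A window that touches an exchanged position is a window of \<open>x'\<close>
      translated by \<open>inv c\<close>; any other window is one of \<open>y\<close>.\<close>
    proof (cases "\<exists>w\<in>W. \<exists>c\<in>S. w \<otimes> (g \<otimes> inv c) \<in> D")
      case True
      then obtain w c where wc: "w \<in> W" "c \<in> S" "w \<otimes> (g \<otimes> inv c) \<in> D" by blast
      have c: "c \<in> carrier G" using wc S C by blast
      have "z S (v \<otimes> g) = x' (v \<otimes> (g \<otimes> inv c))" if v: "v \<in> W" for v
      proof -
        have "v \<otimes> (g \<otimes> inv c) \<in> E" using E[OF wc(1) v _ wc(3)] g c by simp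
        then have "z S ((v \<otimes> (g \<otimes> inv c)) \<otimes> c) = x' (v \<otimes> (g \<otimes> inv c))"
          using z_in S wc by blast
        moreover have "(v \<otimes> (g \<otimes> inv c)) \<otimes> c = v \<otimes> g"
          using v W g c by (auto simp: m_assoc)
        ultimately show ?thesis by simp
      qed
      then show ?thesis using pts(2) c by blast
    next
      case False
      have "z S (w \<otimes> g) = y (w \<otimes> (g \<otimes> \<one>))" if w: "w \<in> W" for w
      proof -
        have "w \<otimes> g \<otimes> inv c \<notin> D" if "c \<in> S" for c
        proof -
          have "w \<in> carrier G" "c \<in> carrier G" using w W that S C by auto
          then show ?thesis using False w that g by (auto simp: m_assoc)
        qed
        then show ?thesis using w W g by (subst z_out) auto
      qed
      then show ?thesis using pts(3) one_closed by blast
    qed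
  qed
  have "inj_on (\<lambda>S. restrict (z S) K) (Pow C)"
  proof (rule inj_onI)
    \<comment> \<open>The single coordinate \<open>d0 \<otimes> c\<close>, visible in
      \<open>K\<close>, reveals whether the exchange at \<open>c\<close> took place, so
      \<open>S\<close> can be recovered.\<close>
    have mem: "c \<in> S \<longleftrightarrow> restrict (z S) K (d0 \<otimes> c) = x' d0" if "S \<subseteq> C" "c \<in> C" for S c
    proof (cases "c \<in> S")
      case True
      then show ?thesis using z_in[OF that(1) True, of d0] K(3)[OF that(2)] d0 D by auto
    next
      case False
      have d0E: "d0 \<in> E" using d0 D by blast
      have "(d0 \<otimes> c) \<otimes> inv c' \<notin> D" if c': "c' \<in> S" for c'
        using uniq[of c c' d0] c' False \<open>S \<subseteq> C\<close> \<open>c \<in> C\<close> d0E by auto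
      then have "z S (d0 \<otimes> c) = y (d0 \<otimes> c)"
        using K(2) K(3)[OF that(2)] by (intro z_out) auto
      then show ?thesis using False K(3)[OF that(2)] C(3)[OF that(2) d0E] d0 by simp
    qed
    fix S S' assume "S \<in> Pow C" "S' \<in> Pow C" "restrict (z S) K = restrict (z S') K"
    then show "S = S'" using mem[of S] mem[of S'] by auto
  qed
  moreover have "(\<lambda>S. restrict (z S) K) ` Pow C \<subseteq> patterns K X"
    using zX by (auto simp: patterns_def)
  ultimately have "card (Pow C) \<le> card (patterns K X)"
    by (intro card_inj_on_le finite_patterns[OF sub K(2,1)])
  then show ?thesis using C by (simp add: card_Pow)
qed

section \<open>Separated return positions of a periodic point\<close>

text \<open>Take \<open>C\<close> maximal among separated subsets of \<open>L\<close>. By maximality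
  the translates of \<open>Q\<close> by elements of \<open>C\<close> cover \<open>L\<close>, which
  gives the count.\<close>

lemma exists_separated_subset:
  assumes "finite L" "L \<subseteq> carrier G" "finite Q" "\<one> \<in> Q"
    and "\<And>q. q \<in> Q \<Longrightarrow> inv q \<in> Q"
  obtains C where "C \<subseteq> L" "\<And>c c'. c \<in> C \<Longrightarrow> c' \<in> C \<Longrightarrow> c \<otimes> inv c' \<in> Q \<Longrightarrow> c = c'"
    "card L \<le> card Q * card C"
proof -
  define \<C> where "\<C> = {C \<in> Pow L. \<forall>c\<in>C. \<forall>c'\<in>C. c \<otimes> inv c' \<in> Q \<longrightarrow> c = c'}"
  have "finite \<C>" "\<C> \<noteq> {}" using assms by (auto simp: \<C>_def)
  then obtain C where C: "C \<in> \<C>" "\<And>C'. C' \<in> \<C> \<Longrightarrow> C \<subseteq> C' \<Longrightarrow> C = C'"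
    using finite_has_maximal[of \<C>] by blast
  have CL: "C \<subseteq> L" "finite C" using C assms(1) by (auto simp: \<C>_def intro: finite_subset)
  have "L \<subseteq> (\<Union>c\<in>C. (\<lambda>q. q \<otimes> c) ` Q)"
  proof
    fix l assume l: "l \<in> L"
    then have lc: "l \<in> carrier G" using assms by blast
    have "\<exists>c\<in>C. l \<otimes> inv c \<in> Q"
    proof (cases "l \<in> C")
      case True
      then show ?thesis using lc assms by (intro bexI[of _ l]) auto
    next
      case False
      \<comment> \<open>Adding \<open>l\<close> must break separation, and the offending pair
        involves \<open>l\<close>; closure of \<open>Q\<close> under inverses covers both orders of
        the pair.\<close>
      then have "insert l C \<notin> \<C>" using C(2)[of "insert l C"] by auto
      then obtain c c' where c: "c \<in> insert l C" "c' \<in> insert l C" "c \<otimes> inv c' \<in> Q" "c \<noteq> c'"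
        using l CL by (auto simp: \<C>_def)
      moreover have "\<not> (c \<in> C \<and> c' \<in> C)" using c C(1) by (auto simp: \<C>_def)
      moreover have "inv (c \<otimes> inv c') = c' \<otimes> inv c"
        using c lc CL assms(2) by (subst inv_mult_group) auto
      ultimately show ?thesis using assms(5)[of "c \<otimes> inv c'"] by auto
    qed
    then obtain c where c: "c \<in> C" "l \<otimes> inv c \<in> Q" by blast
    then have "l = (l \<otimes> inv c) \<otimes> c" using lc CL assms(2) by (auto simp: m_assoc subset_iff)
    then show "l \<in> (\<Union>c\<in>C. (\<lambda>q. q \<otimes> c) ` Q)" using c by blast
  qed
  then have "card L \<le> card (\<Union>c\<in>C. (\<lambda>q. q \<otimes> c) ` Q)"
    using CL assms by (intro card_mono) auto
  also have "\<dots> \<le> (\<Sum>c\<in>C. card ((\<lambda>q. q \<otimes> c) ` Q))" using CL by (intro card_UN_le)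
  also have "\<dots> \<le> (\<Sum>c\<in>C. card Q)" using assms by (intro sum_mono card_image_le)
  finally have "card L \<le> card Q * card C" by (simp add: mult.commute)
  with that[of C] CL C(1) show ?thesis by (auto simp: \<C>_def)
qed

text \<open>\<open>T\<close> represents the finite orbit of \<open>y\<close>. Comparing the shifts
  by \<open>inv k \<otimes> d\<close> and by \<open>t\<close> shows that
  \<open>inv d \<otimes> (k \<otimes> t)\<close> fixes \<open>y\<close>. Thus finitely many right
  translations move every \<open>k\<close> to \<open>d\<close> times an element of the
  stabilizer.\<close>

lemma periodic_translates:
  assumes "finite ((\<lambda>g. shift G g y) ` carrier G)" "d \<in> carrier G"
  obtains T where "finite T" "T \<noteq> {}" "T \<subseteq> carrier G"
    "\<And>k. k \<in> carrier G \<Longrightarrow> \<exists>t\<in>T. \<forall>e\<in>carrier G. y (e \<otimes> (inv d \<otimes> (k \<otimes> t))) = y e"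
proof -
  obtain T where T: "T \<subseteq> carrier G" "finite T" "(\<lambda>g. shift G g y) ` carrier G = (\<lambda>g. shift G g y) ` T"
    using finite_subset_image[OF assms(1) order_refl] by blast
  have "\<exists>t\<in>T. \<forall>e\<in>carrier G. y (e \<otimes> (inv d \<otimes> (k \<otimes> t))) = y e" if k: "k \<in> carrier G" for k
  proof -
    have "shift G (inv k \<otimes> d) y \<in> (\<lambda>g. shift G g y) ` T"
      unfolding T(3)[symmetric] using k assms(2) by auto
    then obtain t where t: "t \<in> T" "shift G (inv k \<otimes> d) y = shift G t y" by blast
    have tc: "t \<in> carrier G" using t T by blast
    have "y (e \<otimes> (inv d \<otimes> (k \<otimes> t))) = y e" if e: "e \<in> carrier G" for e
    proof -
      have "shift G (inv k \<otimes> d) y (e \<otimes> (inv d \<otimes> k)) = shift G t y (e \<otimes> (inv d \<otimes> k))"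
        by (simp add: t)
      then show ?thesis using e k tc assms(2) by (simp add: shift_def m_assoc)
    qed
    with t(1) show ?thesis by blast
  qed
  moreover have "T \<noteq> {}" using T(3) by auto
  ultimately show ?thesis using that T by blast
qed

text \<open>Prescribing the finitely many coordinates in \<open>E\<close> defines an open cylinder
  around \<open>x\<close>, which density forces to contain a periodic point.\<close>

lemma ex_periodic_point_agreeing:
  assumes "X \<subseteq> carrier G \<rightarrow>\<^sub>E {1..m}" "X \<subseteq> full_shift G m closure_of periodic_points G X"
    and "x \<in> X" "finite E" "E \<subseteq> carrier G"
  obtains y where "y \<in> periodic_points G X" "\<And>e. e \<in> E \<Longrightarrow> y e = x e"
proof -
  define U where "U = (\<Pi>\<^sub>E g\<in>carrier G. if g \<in> E then {x g} else {1..m})"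
  have xr: "x g \<in> {1..m}" if "g \<in> carrier G" for g using assms(1,3) that by (auto simp: PiE_iff)
  have "{i \<in> carrier G. (if i \<in> E then {x i} else {1..m}) \<noteq> {1..m}} \<subseteq> E" by auto
  then have "finite {i \<in> carrier G. (if i \<in> E then {x i} else {1..m}) \<noteq> {1..m}}"
    using assms(4) finite_subset by blast
  then have "openin (full_shift G m) U"
    using xr by (auto simp: U_def full_shift_def openin_PiE_gen)
  moreover have "x \<in> U"
    using assms(1,3) xr by (auto simp: U_def PiE_iff)
  moreover have "x \<in> full_shift G m closure_of periodic_points G X" using assms by blast
  ultimately obtain y where y: "y \<in> periodic_points G X" "y \<in> U"
    by (auto simp: in_closure_of)
  moreover have "y e = x e" if "e \<in> E" for e
    using y(2) that assms(5) by (auto simp: U_def PiE_iff subset_iff split: if_splits)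
  ultimately show ?thesis using that by blast
qed

text \<open>The constant is \<open>ln 2 / (card T * card Q)\<close>: a factor \<open>card T\<close>
  is lost in moving to return positions and \<open>card Q\<close> in separating them. Both sets are
  fixed before \<open>K\<close>, hence the uniformity.\<close>

lemma linear_lower_bound:
  assumes sft: "allowed_by_windows W XW m X"
    and inv: "\<And>g. g \<in> carrier G \<Longrightarrow> shift G g ` X = X"
    and dense: "X \<subseteq> full_shift G m closure_of periodic_points G X"
    and nontriv: "nontrivial_relation (homoclinic_relation G X)"
  obtains c :: real where "c > 0"
    "\<And>K. finite K \<Longrightarrow> K \<subseteq> carrier G \<Longrightarrow> c * card K \<le> ln (card (patterns K X))"
proof -
  have sub: "X \<subseteq> carrier G \<rightarrow>\<^sub>E {1..m}" and W: "finite W" "W \<noteq> {}" "W \<subseteq> carrier G"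
    using sft by (auto simp: allowed_by_windows_def)
  obtain x x' F where x: "x \<in> X" "x' \<in> X" "x \<noteq> x'" "finite F"
      "\<And>g. g \<in> carrier G - F \<Longrightarrow> x g = x' g"
    using nontriv by (auto simp: nontrivial_relation_def homoclinic_relation_def)
  define D where "D = {g \<in> carrier G. x g \<noteq> x' g}"
  have D: "finite D" "D \<subseteq> carrier G" "\<And>g. g \<in> carrier G - D \<Longrightarrow> x g = x' g"
    using x(4,5) by (auto simp: D_def intro: finite_subset[of _ F])
  have "x \<in> extensional (carrier G)" "x' \<in> extensional (carrier G)"
    using x sub by (auto simp: PiE_def)
  then obtain d0 where d0: "d0 \<in> D" "x d0 \<noteq> x' d0"
    using extensionalityI[of x "carrier G" x'] x(3) by (auto simp: D_def)
  \<comment> \<open>If \<open>w \<otimes> g = d\<close>, then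
    \<open>w' \<otimes> g = w' \<otimes> (inv w \<otimes> d)\<close>, so \<open>E\<close> contains
    all windows meeting \<open>D\<close>.\<close>
  define E where "E = D \<union> (\<lambda>(w', w, d). w' \<otimes> (inv w \<otimes> d)) ` (W \<times> W \<times> D)"
  have E: "finite E" "D \<subseteq> E" "E \<subseteq> carrier G"
    using D W by (auto simp: E_def subset_iff)
  have winE: "w' \<otimes> g \<in> E" if "w \<in> W" "w' \<in> W" "g \<in> carrier G" "w \<otimes> g \<in> D" for w w' g
  proof -
    have "w' \<otimes> g = (\<lambda>(w', w, d). w' \<otimes> (inv w \<otimes> d)) (w', w, w \<otimes> g)"
      using that W by auto
    moreover have "(w', w, w \<otimes> g) \<in> W \<times> W \<times> D" using that by blast
    ultimately show ?thesis unfolding E_def by blast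
  qed
  obtain y where y: "y \<in> periodic_points G X" "\<And>e. e \<in> E \<Longrightarrow> y e = x e"
    using ex_periodic_point_agreeing[OF sub dense x(1) E(1,3)] by blast
  have yX: "y \<in> X" and "finite ((\<lambda>g. shift G g y) ` carrier G)"
    using y by (auto simp: periodic_points_def)
  then obtain T where T: "finite T" "T \<noteq> {}" "T \<subseteq> carrier G"
      "\<And>k. k \<in> carrier G \<Longrightarrow> \<exists>t\<in>T. \<forall>e\<in>carrier G. y (e \<otimes> (inv d0 \<otimes> (k \<otimes> t))) = y e"
    using periodic_translates[of y d0] d0 D by blast
  \<comment> \<open>A collision \<open>e \<otimes> c = d \<otimes> c'\<close> means
    \<open>c \<otimes> inv c' = inv e \<otimes> d\<close>. The inverses are included to make
    \<open>Q\<close> symmetric.\<close>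
  define Q where "Q = (\<Union>e\<in>E. \<Union>d\<in>D. {inv e \<otimes> d, inv d \<otimes> e})"
  have d0c: "d0 \<in> carrier G" "d0 \<in> E" using d0 D E by auto
  have Q: "finite Q" using D E by (simp add: Q_def)
  have "\<one> = inv d0 \<otimes> d0" using d0c by simp
  then have Q1: "\<one> \<in> Q" using d0 d0c unfolding Q_def by blast
  have Qi: "inv q \<in> Q" if q: "q \<in> Q" for q
  proof -
    obtain e d where ed: "e \<in> E" "d \<in> D" "q = inv e \<otimes> d \<or> q = inv d \<otimes> e"
      using q unfolding Q_def by blast
    then have "e \<in> carrier G" "d \<in> carrier G" using E D by auto
    then have "inv q = inv d \<otimes> e \<or> inv q = inv e \<otimes> d"
      using ed(3) by (auto simp: inv_mult_group)
    then show ?thesis using ed(1,2) unfolding Q_def by blast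
  qed
  have TQ: "card T * card Q > 0" using T Q Q1 by (auto simp: card_gt_0_iff)
  have "ln 2 / (card T * card Q) * card K \<le> ln (card (patterns K X))"
    if K: "finite K" "K \<subseteq> carrier G" for K
  proof -
    \<comment> \<open>The sets \<open>KT t\<close> cover \<open>K\<close>, so by pigeonhole one of
      them has at least \<open>card K / card T\<close> elements.\<close>
    define KT where "KT t = {k \<in> K. \<forall>e\<in>carrier G. y (e \<otimes> (inv d0 \<otimes> (k \<otimes> t))) = y e}" for t
    have "K \<subseteq> (\<Union>t\<in>T. KT t)"
    proof
      fix k assume k: "k \<in> K"
      then obtain t where "t \<in> T" "\<forall>e\<in>carrier G. y (e \<otimes> (inv d0 \<otimes> (k \<otimes> t))) = y e"
        using T(4) K by blast
      then show "k \<in> (\<Union>t\<in>T. KT t)" using k unfolding KT_def by blast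
    qed
    then have "card K \<le> card (\<Union>t\<in>T. KT t)"
      using T(1) K(1) by (intro card_mono) (simp_all add: KT_def)
    also have "\<dots> \<le> (\<Sum>t\<in>T. card (KT t))" using T(1) by (rule card_UN_le)
    also have "\<dots> \<le> card T * Max ((\<lambda>t. card (KT t)) ` T)"
      using sum_bounded_above[of T "\<lambda>t. card (KT t)"] T(1) by simp
    finally have le: "card K \<le> card T * Max ((\<lambda>t. card (KT t)) ` T)" .
    have "Max ((\<lambda>t. card (KT t)) ` T) \<in> (\<lambda>t. card (KT t)) ` T"
      using T(1,2) by (intro Max_in) auto
    with le obtain t where t: "t \<in> T" "card K \<le> card T * card (KT t)"
      by fastforce
    have tc: "t \<in> carrier G" using t T by blast
    \<comment> \<open>Each \<open>c \<in> L\<close> fixes \<open>y\<close>, so \<open>y\<close>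
      repeats the block of \<open>x\<close> on \<open>E \<otimes> c\<close>, and
      \<open>d0 \<otimes> c\<close> lies in \<open>K #> t\<close>. Shift invariance later replaces
      \<open>K #> t\<close> by \<open>K\<close>.\<close>
    define L where "L = (\<lambda>k. inv d0 \<otimes> (k \<otimes> t)) ` KT t"
    have KTc: "k \<in> carrier G" if "k \<in> KT t" for k using that K by (auto simp: KT_def)
    have L: "finite L" "L \<subseteq> carrier G" using K KTc tc d0c by (auto simp: L_def KT_def)
    have "inj_on (\<lambda>k. inv d0 \<otimes> (k \<otimes> t)) (KT t)"
      using KTc tc d0c by (auto intro!: inj_onI)
    then have cL: "card L = card (KT t)" by (simp add: L_def card_image)
    obtain C where C: "C \<subseteq> L" "\<And>c c'. c \<in> C \<Longrightarrow> c' \<in> C \<Longrightarrow> c \<otimes> inv c' \<in> Q \<Longrightarrow> c = c'"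
        "card L \<le> card Q * card C"
      using exists_separated_subset[OF L Q Q1 Qi] by blast
    have Cc: "C \<subseteq> carrier G" "finite C" using C(1) L by (auto intro: finite_subset)
    have Kt: "finite (K #> t)" "K #> t \<subseteq> carrier G" using K tc by (auto simp: r_coset_eq_image)
    have "2 ^ card C \<le> card (patterns (K #> t) X)"
    proof (rule two_power_le_card_patterns[OF sft x(1,2) yX E(2,3) D(3) d0 winE Cc(2,1) _ _ Kt])
      show "y (e \<otimes> c) = x e" if "c \<in> C" "e \<in> E" for c e
      proof -
        have "e \<in> carrier G" using that E by blast
        moreover have "c \<in> L" using that C by blast
        ultimately show ?thesis using y(2)[OF that(2)] by (auto simp: L_def KT_def)
      qed
      show "c = c'" if "c \<in> C" "c' \<in> C" "e \<in> E" "d \<in> D" "e \<otimes> c = d \<otimes> c'" for c c' e d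
      proof -
        have carr: "c \<in> carrier G" "c' \<in> carrier G" "e \<in> carrier G" "d \<in> carrier G"
          using that Cc E D by auto
        have "c = inv e \<otimes> (e \<otimes> c)" using carr by simp
        also have "\<dots> = inv e \<otimes> d \<otimes> c'" using carr that(5) by (simp add: m_assoc)
        finally have "c \<otimes> inv c' = inv e \<otimes> d" using carr by (simp add: m_assoc)
        then have "c \<otimes> inv c' \<in> Q" using that by (auto simp: Q_def)
        then show ?thesis using C(2) that by blast
      qed
      show "d0 \<otimes> c \<in> K #> t" if c: "c \<in> C" for c
      proof -
        obtain k where k: "k \<in> KT t" "c = inv d0 \<otimes> (k \<otimes> t)" using c C by (auto simp: L_def)
        then have "d0 \<otimes> c = k \<otimes> t" using KTc tc d0c by simp
        then show ?thesis using k by (auto simp: r_coset_eq_image KT_def)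
      qed
    qed auto
    also have "\<dots> = card (patterns K X)"
      using card_patterns_r_coset[OF inv[OF tc] tc K(2)] .
    finally have "real (2 ^ card C) \<le> card (patterns K X)" by (simp only: of_nat_le_iff)
    then have "ln (real (2 ^ card C)) \<le> ln (card (patterns K X))"
      by (intro ln_mono) auto
    then have "card C * ln 2 \<le> ln (card (patterns K X))" by (simp add: ln_realpow)
    moreover have "card K \<le> (card T * card Q) * card C"
      using t(2) C(3) cL by (metis mult.assoc mult_le_mono2 order_trans)
    then have "real (card K) \<le> (card T * card Q) * card C"
      by (metis of_nat_le_iff of_nat_mult)
    then have "real (card K) / (card T * card Q) \<le> card C"
      using TQ by (subst pos_divide_le_eq) (auto simp: mult.commute simp flip: of_nat_mult)
    then have "ln 2 * (real (card K) / (card T * card Q)) \<le> ln 2 * card C"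
      by (intro mult_left_mono) auto
    ultimately show ?thesis by (simp add: mult.commute)
  qed
  moreover have "ln 2 / (card T * card Q) > (0::real)"
    using TQ by (intro divide_pos_pos) (simp_all only: of_nat_0_less_iff, simp)
  ultimately show ?thesis using that by blast
qed

section \<open>Zero entropy from a trivial homoclinic relation\<close>

text \<open>If two points of \<open>X\<close> agree on the inner boundary of \<open>F\<close>,
  replacing the first by the second on \<open>F\<close> stays in \<open>X\<close> and yields a point
  homoclinic to the first. Triviality then makes the two agree on \<open>F\<close>, so boundary
  values determine the pattern.\<close>

lemma card_patterns_le_boundary:
  assumes sft: "allowed_by_windows W XW m X"
    and triv: "\<not> nontrivial_relation (homoclinic_relation G X)"
    and F: "finite F" "F \<subseteq> carrier G"
  shows "card (patterns F X) \<le> m ^ card {b \<in> F. \<exists>w\<in>W. \<exists>w'\<in>W. w' \<otimes> (inv w \<otimes> b) \<notin> F}"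
proof -
  define B where "B = {b \<in> F. \<exists>w\<in>W. \<exists>w'\<in>W. w' \<otimes> (inv w \<otimes> b) \<notin> F}"
  have sub: "X \<subseteq> carrier G \<rightarrow>\<^sub>E {1..m}" and W: "finite W" "W \<noteq> {}" "W \<subseteq> carrier G"
    using sft by (auto simp: allowed_by_windows_def)
  have BF: "B \<subseteq> F" by (auto simp: B_def)
  have agree: "restrict x F = restrict x' F"
    if x: "x \<in> X" "x' \<in> X" and eq: "\<And>b. b \<in> B \<Longrightarrow> x b = x' b" for x x'
  proof -
    define u where "u g = (if g \<in> F then x' g else x g)" for g
    have "u \<in> X"
    proof (rule mem_by_windows[OF sft])
      show "u \<in> carrier G \<rightarrow>\<^sub>E {1..m}"
        using x sub F by (fastforce simp: u_def PiE_iff extensional_def)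
      fix g assume g: "g \<in> carrier G"
      show "\<exists>v\<in>X. \<exists>c\<in>carrier G. \<forall>w\<in>W. u (w \<otimes> g) = v (w \<otimes> (g \<otimes> c))"
      \<comment> \<open>A window leaving \<open>F\<close> meets \<open>F\<close> only in boundary
        points, where \<open>x\<close> and \<open>x'\<close> agree, so it is a window of
        \<open>x\<close>. A window inside \<open>F\<close> is one of \<open>x'\<close>.\<close>
      proof (cases "\<exists>w\<in>W. w \<otimes> g \<notin> F")
        case True
        then obtain w' where w': "w' \<in> W" "w' \<otimes> g \<notin> F" by blast
        have "u (w \<otimes> g) = x (w \<otimes> (g \<otimes> \<one>))" if w: "w \<in> W" for w
        proof -
          have "w' \<otimes> (inv w \<otimes> (w \<otimes> g)) \<notin> F" using w w' W g by auto
          then have "w \<otimes> g \<in> B" if "w \<otimes> g \<in> F" using that w w' by (auto simp: B_def)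
          then show ?thesis using eq g by (auto simp: u_def)
        qed
        then show ?thesis using x one_closed by blast
      next
        case False
        then have "u (w \<otimes> g) = x' (w \<otimes> (g \<otimes> \<one>))" if "w \<in> W" for w
          using that g by (auto simp: u_def)
        then show ?thesis using x one_closed by blast
      qed
    qed
    then have "(x, u) \<in> homoclinic_relation G X"
      using x F by (auto simp: homoclinic_relation_def u_def)
    then have "x = u" using triv by (auto simp: nontrivial_relation_def)
    then show ?thesis by (metis restrict_ext u_def)
  qed
  have "inj_on (\<lambda>f. restrict f B) (patterns F X)"
  proof (rule inj_onI)
    fix f g assume fg: "f \<in> patterns F X" "g \<in> patterns F X" "restrict f B = restrict g B"
    then obtain x x' where x: "x \<in> X" "x' \<in> X" "f = restrict x F" "g = restrict x' F"
      by (auto simp: patterns_def)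
    have "x b = x' b" if "b \<in> B" for b
      using fun_cong[OF fg(3), of b] that BF x by auto
    then show "f = g" using agree x by blast
  qed
  then have "card (patterns F X) = card (patterns B (patterns F X))"
    by (simp add: card_image patterns_def[of B])
  also have "\<dots> = card (patterns B X)" by (simp add: patterns_patterns BF)
  also have "\<dots> \<le> m ^ card B"
    using BF F by (intro card_patterns_le[OF sub]) (auto intro: finite_subset)
  finally show ?thesis by (simp add: B_def)
qed

text \<open>A boundary point \<open>b\<close> with witnesses \<open>w\<close>, \<open>w'\<close>
  lies in \<open>F\<close> but not in \<open>(w \<otimes> inv w') <# F\<close>, so the boundary is
  covered by finitely many Folner error sets.\<close>

lemma card_boundary_le:
  assumes W: "finite W" "W \<subseteq> carrier G" and F: "finite F" "F \<subseteq> carrier G"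
  shows "card {b \<in> F. \<exists>w\<in>W. \<exists>w'\<in>W. w' \<otimes> (inv w \<otimes> b) \<notin> F}
    \<le> (\<Sum>(w, w')\<in>W \<times> W. card (sym_diff ((w \<otimes> inv w') <# F) F))"
proof -
  have "{b \<in> F. \<exists>w\<in>W. \<exists>w'\<in>W. w' \<otimes> (inv w \<otimes> b) \<notin> F}
      \<subseteq> (\<Union>(w, w')\<in>W \<times> W. sym_diff ((w \<otimes> inv w') <# F) F)"
  proof
    fix b assume "b \<in> {b \<in> F. \<exists>w\<in>W. \<exists>w'\<in>W. w' \<otimes> (inv w \<otimes> b) \<notin> F}"
    then obtain w w' where b: "b \<in> F" "w \<in> W" "w' \<in> W" "w' \<otimes> (inv w \<otimes> b) \<notin> F" by blast
    have "b \<notin> (w \<otimes> inv w') <# F"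
    proof
      assume "b \<in> (w \<otimes> inv w') <# F"
      then obtain f where f: "f \<in> F" "b = (w \<otimes> inv w') \<otimes> f" by (auto simp: l_coset_eq_image)
      have "w \<in> carrier G" "w' \<in> carrier G" "f \<in> carrier G" using b f W F by auto
      then have "w' \<otimes> (inv w \<otimes> b) = f" unfolding f(2) by (simp add: m_assoc)
      with b(4) f(1) show False by simp
    qed
    then show "b \<in> (\<Union>(w, w')\<in>W \<times> W. sym_diff ((w \<otimes> inv w') <# F) F)" using b by blast
  qed
  then have "card {b \<in> F. \<exists>w\<in>W. \<exists>w'\<in>W. w' \<otimes> (inv w \<otimes> b) \<notin> F}
      \<le> card (\<Union>(w, w')\<in>W \<times> W. sym_diff ((w \<otimes> inv w') <# F) F)"
    using W F by (intro card_mono) (auto simp: l_coset_eq_image)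
  also have "\<dots> \<le> (\<Sum>p\<in>W \<times> W. card (case p of (w, w') \<Rightarrow> sym_diff ((w \<otimes> inv w') <# F) F))"
    using W by (intro card_UN_le) auto
  finally show ?thesis by (simp add: case_prod_unfold)
qed

lemma entropy_limit_zero:
  assumes X: "subshift G m X" and sft: "allowed_by_windows W XW m X"
    and triv: "\<not> nontrivial_relation (homoclinic_relation G X)"
    and F: "folner_sequence G F"
  shows "(\<lambda>n. ln (card (patterns (F n) X)) / card (F n)) \<longlonglongrightarrow> 0"
proof -
  have sub: "X \<subseteq> carrier G \<rightarrow>\<^sub>E {1..m}" and ne: "X \<noteq> {}"
    using subshift_subset[OF X] X by (auto simp: subshift_def)
  have W: "finite W" "W \<noteq> {}" "W \<subseteq> carrier G"
    using sft by (auto simp: allowed_by_windows_def)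
  have Fn: "finite (F n)" "F n \<noteq> {}" "F n \<subseteq> carrier G" for n
    using F by (auto simp: folner_sequence_def)
  have pos: "card (patterns (F n) X) > 0" for n
    using Fn by (intro card_patterns_pos finite_patterns[OF sub] ne)
  obtain x where "x \<in> X" using ne by blast
  then have "x \<one> \<in> {1..m}" using sub by (auto simp: PiE_iff)
  \<comment> \<open>A value of a point of \<open>X\<close> forces the alphabet to be nonempty, so
    that \<open>ln m\<close> is nonnegative.\<close>
  then have m: "m \<ge> 1" by simp
  define r where "r n = (\<Sum>p\<in>W \<times> W. real (card (sym_diff ((fst p \<otimes> inv (snd p)) <# F n) (F n))) / card (F n))" for n
  have "r \<longlonglongrightarrow> (\<Sum>p\<in>W \<times> W. 0)"
    unfolding r_def
  proof (intro tendsto_sum)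
    fix p assume "p \<in> W \<times> W"
    then have "fst p \<otimes> inv (snd p) \<in> carrier G" using W by (auto simp: subset_iff)
    then show "(\<lambda>n. real (card (sym_diff ((fst p \<otimes> inv (snd p)) <# F n) (F n))) / card (F n)) \<longlonglongrightarrow> 0"
      using F unfolding folner_sequence_def by blast
  qed
  then have "r \<longlonglongrightarrow> 0" by simp
  then have lim: "(\<lambda>n. r n * ln m) \<longlonglongrightarrow> 0" by (rule tendsto_mult_left_zero)
  have upper: "ln (card (patterns (F n) X)) / card (F n) \<le> r n * ln m" for n
  proof -
    let ?B = "{b \<in> F n. \<exists>w\<in>W. \<exists>w'\<in>W. w' \<otimes> (inv w \<otimes> b) \<notin> F n}"
    have "real (card (patterns (F n) X)) \<le> real (m ^ card ?B)"
      using card_patterns_le_boundary[OF sft triv Fn(1,3)] by (simp only: of_nat_le_iff)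
    then have "ln (card (patterns (F n) X)) \<le> ln (real (m ^ card ?B))"
      using pos[of n] by (intro ln_mono) auto
    also have "\<dots> = card ?B * ln m" using m by (simp add: ln_realpow)
    also have "\<dots> \<le> (\<Sum>(w, w')\<in>W \<times> W. card (sym_diff ((w \<otimes> inv w') <# F n) (F n))) * ln m"
      using card_boundary_le[OF W(1,3) Fn(1,3)] m by (intro mult_right_mono) (simp_all only: of_nat_le_iff, simp)
    also have "\<dots> = card (F n) * (r n * ln m)"
      using Fn by (simp add: r_def sum_divide_distrib[symmetric] case_prod_unfold)
    finally show ?thesis using Fn by (simp add: divide_le_eq mult.commute card_gt_0_iff)
  qed
  have lower: "0 \<le> ln (card (patterns (F n) X)) / card (F n)" for n
    using pos[of n] by (simp add: Suc_le_eq)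
  show ?thesis
    by (rule tendsto_sandwich[OF _ _ tendsto_const lim]) (simp_all only: lower upper eventually_True)
qed

end

theorem theorem1p4:
  fixes G :: "('a, 'b) monoid_scheme" and m :: nat and X :: "('a \<Rightarrow> nat) set"
  assumes "group G"
    and "infinite (carrier G)"
    and "countable (carrier G)"
    and "residually_finite G"
    and "amenable G"
    and "m \<ge> 2"
    and "shift_of_finite_type G m X"
    and "X \<subseteq> full_shift G m closure_of periodic_points G X"
  shows "topological_entropy G X > 0 \<longleftrightarrow> nontrivial_relation (homoclinic_relation G X)"
proof -
  interpret group G by fact
  have X: "subshift G m X" using assms(7) by (simp add: shift_of_finite_type_def)
  obtain W XW where sft: "allowed_by_windows W XW m X"
    using assms(7) by (auto simp: shift_of_finite_type_def allowed_by_windows_def)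
  show ?thesis
  proof
    assume pos: "topological_entropy G X > 0"
    show "nontrivial_relation (homoclinic_relation G X)"
    proof (rule ccontr)
      assume "\<not> nontrivial_relation (homoclinic_relation G X)"
      then have "topological_entropy G X = 0"
        by (intro topological_entropy_eqI[OF assms(5)] entropy_limit_zero[OF X sft])
      with pos show False by simp
    qed
  next
    assume "nontrivial_relation (homoclinic_relation G X)"
    then obtain c :: real where c: "c > 0"
        "\<And>K. finite K \<Longrightarrow> K \<subseteq> carrier G \<Longrightarrow> c * card K \<le> ln (card (patterns K X))"
      using linear_lower_bound[OF sft _ assms(8)] X by (auto simp: subshift_def)
    let ?S = "{K. finite K \<and> K \<noteq> {} \<and> K \<subseteq> carrier G}"
    \<comment> \<open>The infimum formula turns the bound \<open>c\<close>, valid for every finite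
      \<open>K\<close>, directly into a lower bound for the entropy.\<close>
    have "topological_entropy G X = (INF K\<in>?S. ln (card (patterns K X)) / card K)"
      by (intro topological_entropy_eqI[OF assms(5)] entropy_limit[OF X])
    moreover have "c \<le> (INF K\<in>?S. ln (card (patterns K X)) / card K)"
    proof (rule cINF_greatest)
      have "{\<one>\<^bsub>G\<^esub>} \<in> ?S" by simp
      then show "?S \<noteq> {}" by (metis empty_iff)
      fix K assume "K \<in> ?S"
      then show "c \<le> ln (card (patterns K X)) / card K"
        using c(2)[of K] by (simp add: pos_le_divide_eq card_gt_0_iff)
    qed
    ultimately show "topological_entropy G X > 0" using c(1) by linarith
  qed
qed

end
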